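(* Let $m\geq 2$ be an integer, let $n_1=m(m+1)$, $n_2=m(m+1)+1$, $n_3=(m+1)^2$, $n_4=(m+1)^2+1$, and let $\mathfrak{S}_m=\langle n_1,n_2,n_3,n_4\rangle$. Then each element of $\mathrm{Ap}(\mathfrak{S}_m,n_1)$ has a unique expression; that is, for every $x\in\mathrm{Ap}(\mathfrak{S}_m,n_1)$ there is exactly one vector $(s_1,s_2,s_3,s_4)$ of non-negative integers with $x=s_1n_1+s_2n_2+s_3n_3+s_4n_4$.
   Context: $\langle a_1,\dots,a_e\rangle$ denotes the set of all non-negative integer combinations of $a_1,\dots,a_e$. For a numerical semigroup $\Gamma$ and $0\neq a\in\Gamma$, the Apéry set is $\mathrm{Ap}(\Gamma,a)=\{s\in\Gamma\mid s-a\notin\Gamma\}$. *)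

theory Defs
  imports Main
begin

definition generated_semigroup :: "nat list \<Rightarrow> nat set" where
  "generated_semigroup as =
     {\<Sum>i<length as. c ! i * as ! i | c :: nat list. length c = length as}"

text \<open>The difference \<open>s - a\<close> is formed in the integers: for \<open>s < a\<close> it is negative, hence not in
  \<open>\<Gamma>\<close>. Truncated subtraction would lose these elements, among them \<open>0\<close>.\<close>

definition Apery :: "nat set \<Rightarrow> nat \<Rightarrow> nat set" where
  "Apery \<Gamma> a = {s \<in> \<Gamma>. int s - int a \<notin> int ` \<Gamma>}"

end

theory Submission
  imports Defs
begin

text \<open>Put \<open>d = s1 + s2 + s3 + s4\<close>, \<open>b = s2 + s4\<close> and \<open>c = s3 + s4\<close>. The combination with
  coefficients \<open>s1, s2, s3, s4\<close> equals \<open>(d * m + c) * (m + 1) + b\<close>. An element of the Apery set has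
  no expression with a positive coefficient of \<open>n1\<close>, so \<open>s1 = 0\<close>, and the relations
  \<open>n2 + n3 = n1 + n4\<close>,
  \<open>(m - j) * n3 + j * n4 = (m + 1 - j) * n1 + j * n2\<close> for \<open>j \<le> m\<close>, and
  \<open>(m + 1 - j) * n2 + j * n4 = (m - j) * n1 + (j + 1) * n3\<close> for \<open>j < m\<close>
  force \<open>s2 = 0\<close> or \<open>s3 = 0\<close>, then \<open>c < m\<close> and \<open>b \<le> m\<close>. Hence \<open>b\<close>, \<open>c\<close>, \<open>d\<close> are the digits of
  the element in a mixed-radix expansion, and they determine the coefficients.\<close>

lemma generated_semigroup_4:
  "generated_semigroup [n1, n2, n3, n4] =
     {s1 * n1 + s2 * n2 + s3 * n3 + s4 * n4 | s1 s2 s3 s4. True}"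
proof (intro set_eqI iffI)
  fix x assume "x \<in> generated_semigroup [n1, n2, n3, n4]"
  then show "x \<in> {s1 * n1 + s2 * n2 + s3 * n3 + s4 * n4 | s1 s2 s3 s4. True}"
    by (auto simp: generated_semigroup_def eval_nat_numeral)
next
  fix x assume "x \<in> {s1 * n1 + s2 * n2 + s3 * n3 + s4 * n4 | s1 s2 s3 s4. True}"
  then obtain s1 s2 s3 s4 where "x = s1 * n1 + s2 * n2 + s3 * n3 + s4 * n4"
    by blast
  then show "x \<in> generated_semigroup [n1, n2, n3, n4]"
    unfolding generated_semigroup_def
    by (intro CollectI exI[of _ "[s1, s2, s3, s4]"]) (simp add: eval_nat_numeral)
qed

lemma Apery_add_notin:
  assumes "x \<in> Apery \<Gamma> a" "y \<in> \<Gamma>"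
  shows "x \<noteq> a + y"
  using assms by (auto simp: Apery_def)

text \<open>If a bound failed, the expression would contain one side of a relation between the
  generators; exchanging it for the other side produces a summand \<open>n1\<close>, which
  \<open>no\<close> forbids.\<close>

lemma coefficient_bounds:
  fixes m :: nat
  defines "n1 \<equiv> m * (m + 1)" and "n2 \<equiv> m * (m + 1) + 1"
    and "n3 \<equiv> (m + 1)^2" and "n4 \<equiv> (m + 1)^2 + 1"
  assumes x: "x = s1 * n1 + s2 * n2 + s3 * n3 + s4 * n4"
    and no: "\<And>u1 u2 u3 u4. x \<noteq> n1 + (u1 * n1 + u2 * n2 + u3 * n3 + u4 * n4)"
  shows "s1 = 0" "s2 = 0 \<or> s3 = 0" "s3 + s4 < m" "s2 + s4 \<le> m"
proof -
  note n_defs = n1_def n2_def n3_def n4_def power2_eq_square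
  show "s1 = 0"
  proof (rule ccontr)
    assume "s1 \<noteq> 0"
    then obtain k where "s1 = Suc k" by (cases s1) auto
    then show False using x no[of k s2 s3 s4] by simp
  qed
  show s23: "s2 = 0 \<or> s3 = 0"
  proof (rule ccontr)
    assume "\<not> ?thesis"
    then obtain k l where "s2 = Suc k" "s3 = Suc l" by (cases s2; cases s3) auto
    then show False using x no[of s1 k l "Suc s4"] by (simp add: n_defs algebra_simps)
  qed
  show c: "s3 + s4 < m"
  proof (rule ccontr)
    assume ge: "\<not> ?thesis"
    \<comment> \<open>Exactly \<open>m\<close> summands are traded: as many \<open>n4\<close> as
      available, up to \<open>m\<close>, and the rest \<open>n3\<close>, of which \<open>ge\<close>
      supplies enough.\<close>
    define j where "j = min s4 m"
    have j: "j \<le> m" "j \<le> s4" "m \<le> s3 + j" using ge by (auto simp: j_def)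
    obtain k where m: "m = j + k" using le_Suc_ex[OF j(1)] by blast
    obtain p where p: "s4 = j + p" using le_Suc_ex[OF j(2)] by blast
    have "k \<le> s3" using j(3) m by linarith
    then obtain q where q: "s3 = k + q" using le_Suc_ex by blast
    have rel: "k * n3 + j * n4 = n1 + (k * n1 + j * n2)"
      by (simp add: n_defs m algebra_simps)
    have "x = s1 * n1 + s2 * n2 + q * n3 + p * n4 + (k * n3 + j * n4)"
      by (simp add: x p q algebra_simps)
    also have "\<dots> = n1 + ((s1 + k) * n1 + (s2 + j) * n2 + q * n3 + p * n4)"
      unfolding rel by (simp add: algebra_simps)
    finally show False using no by blast
  qed
  show "s2 + s4 \<le> m"
  proof (rule ccontr)
    assume ge: "\<not> ?thesis"
    \<comment> \<open>The strict bound \<open>c\<close> gives \<open>s4 < m\<close>, so the third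
      relation applies with \<open>j = s4\<close>. It consumes \<open>m + 1 - s4\<close>, that is
      \<open>k + 2\<close>, copies of \<open>n2\<close>, and \<open>ge\<close> provides
      them.\<close>
    obtain k where m: "m = s4 + Suc k" using less_iff_Suc_add[of s4 m] c by auto
    then obtain q where q: "s2 = Suc (Suc k) + q"
      using ge le_Suc_ex[of "Suc (Suc k)" s2] by auto
    have rel: "Suc (Suc k) * n2 + s4 * n4 = n1 + (k * n1 + Suc s4 * n3)"
      by (simp add: n_defs m algebra_simps)
    have "x = s1 * n1 + q * n2 + s3 * n3 + (Suc (Suc k) * n2 + s4 * n4)"
      by (simp add: x q algebra_simps)
    also have "\<dots> = n1 + ((s1 + k) * n1 + q * n2 + (s3 + Suc s4) * n3 + 0 * n4)"
      unfolding rel by (simp add: algebra_simps)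
    finally show False using no by blast
  qed
qed

lemma mixed_radix_unique:
  fixes m :: nat
  assumes "(d * m + c) * (m + 1) + b = (d' * m + c') * (m + 1) + b'"
    and "b \<le> m" "b' \<le> m" "c < m" "c' < m"
  shows "b = b'" "c = c'" "d = d'"
proof -
  have digits: "q = q' \<and> r = r'" if "q * k + r = q' * k + r'" "r < k" "r' < k"
    for q q' r r' k :: nat
  proof
    show "q = q'" using arg_cong[OF that(1), of "\<lambda>y. y div k"] that(2,3) by simp
    show "r = r'" using arg_cong[OF that(1), of "\<lambda>y. y mod k"] that(2,3) by simp
  qed
  \<comment> \<open>The digits are split off from the lowest: first in base \<open>m + 1\<close>,
    then in base \<open>m\<close>.\<close>
  have "d * m + c = d' * m + c' \<and> b = b'"
    using digits[OF assms(1)] assms(2,3) by simp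
  then show "b = b'" "c = c'" "d = d'"
    using digits[of d m c d' c'] assms(4,5) by simp_all
qed

theorem theorem4p2:
  fixes m n1 n2 n3 n4 :: nat
  assumes "m \<ge> 2"
    and "n1 = m * (m + 1)"
    and "n2 = m * (m + 1) + 1"
    and "n3 = (m + 1)^2"
    and "n4 = (m + 1)^2 + 1"
  shows "\<forall>x \<in> Apery (generated_semigroup [n1, n2, n3, n4]) n1.
           \<exists>!s :: nat \<times> nat \<times> nat \<times> nat.
             case s of (s1, s2, s3, s4) \<Rightarrow> x = s1 * n1 + s2 * n2 + s3 * n3 + s4 * n4"
proof
  fix x assume x: "x \<in> Apery (generated_semigroup [n1, n2, n3, n4]) n1"
  have no: "x \<noteq> n1 + (u1 * n1 + u2 * n2 + u3 * n3 + u4 * n4)" for u1 u2 u3 u4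
    using Apery_add_notin[OF x] unfolding generated_semigroup_4 by blast
  have unique: "(s1, s2, s3, s4) = (t1, t2, t3, t4)"
    if s: "x = s1 * n1 + s2 * n2 + s3 * n3 + s4 * n4"
      and t: "x = t1 * n1 + t2 * n2 + t3 * n3 + t4 * n4"
    for s1 s2 s3 s4 t1 t2 t3 t4
  proof -
    \<comment> \<open>Each generator is \<open>m * (m + 1)\<close>, plus \<open>m + 1\<close> for
      \<open>n3\<close> and \<open>n4\<close>, plus \<open>1\<close> for \<open>n2\<close> and
      \<open>n4\<close>.\<close>
    have expand: "r1 * n1 + r2 * n2 + r3 * n3 + r4 * n4
        = ((r1 + r2 + r3 + r4) * m + (r3 + r4)) * (m + 1) + (r2 + r4)" for r1 r2 r3 r4
      by (simp add: assms(2-5) power2_eq_square algebra_simps)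
    note bs = coefficient_bounds[OF s[unfolded assms(2-5)] no[unfolded assms(2-5)]]
    note bt = coefficient_bounds[OF t[unfolded assms(2-5)] no[unfolded assms(2-5)]]
    have eq: "((s1 + s2 + s3 + s4) * m + (s3 + s4)) * (m + 1) + (s2 + s4)
        = ((t1 + t2 + t3 + t4) * m + (t3 + t4)) * (m + 1) + (t2 + t4)"
      using s t by (simp only: expand)
    \<comment> \<open>As \<open>s1 = 0\<close>, the digits give \<open>s2 = d - c\<close>,
      \<open>s3 = d - b\<close> and \<open>s4 = b + c - d\<close>; likewise for the \<open>t\<close>
      coefficients.\<close>
    show ?thesis
      using mixed_radix_unique[OF eq bs(4) bt(4) bs(3) bt(3)] bs(1,2) bt(1,2) by auto
  qed
  have "x \<in> generated_semigroup [n1, n2, n3, n4]"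
    using x by (simp add: Apery_def)
  then obtain s1 s2 s3 s4 where s: "x = s1 * n1 + s2 * n2 + s3 * n3 + s4 * n4"
    unfolding generated_semigroup_4 by blast
  show "\<exists>!s :: nat \<times> nat \<times> nat \<times> nat.
          case s of (s1, s2, s3, s4) \<Rightarrow> x = s1 * n1 + s2 * n2 + s3 * n3 + s4 * n4"
  proof (rule ex1I[of _ "(s1, s2, s3, s4)"])
    show "case (s1, s2, s3, s4) of (s1, s2, s3, s4) \<Rightarrow>
        x = s1 * n1 + s2 * n2 + s3 * n3 + s4 * n4"
      using s by simp
  next
    fix t :: "nat \<times> nat \<times> nat \<times> nat"
    assume t: "case t of (t1, t2, t3, t4) \<Rightarrow> x = t1 * n1 + t2 * n2 + t3 * n3 + t4 * n4"
    obtain t1 t2 t3 t4 where "t = (t1, t2, t3, t4)" by (cases t) auto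
    then show "t = (s1, s2, s3, s4)"
      using t unique[OF _ s, of t1 t2 t3 t4] by simp
  qed
qed

end
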